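(* There exists $c>0$ satisfying the following. Let $\varepsilon\in(0,1)$ and $n\in\mathbb{N}$. For every local property $\mathcal{P}$ of sequences $f:[n]\to\mathbb{R}$ and every $t\le\frac{c\,\varepsilon^2n}{\log^2(\varepsilon n)}$, there exists an $\varepsilon$-tester for $\mathcal{P}$ with batch size $b=2$ that works in the presence of a $t$-online erasure (or corruption) budget-managing adversary and makes $O\left(\frac{\log(\varepsilon n)}{\varepsilon}\right)$ queries. In the case of erasures, the tester has one-sided error.
   Context: $\log$ is base 2; $[n]=\{1,\dots,n\}$; $t$ is a positive real. A property $\mathcal{P}$ of sequences $f:[n]\to\mathbb{R}$ is local if there is a family $\mathcal{F}\subseteq\mathbb{R}^2$ of forbidden pairs such that $f\in\mathcal{P}$ iff $(f(i),f(i+1))\notin\mathcal{F}$ for all $i\in[n-1]$. Online model with batches. Access to the input $f$ is via a sequence of oracles $\mathcal{O}_1,\mathcal{O}_2,\dots$ with $\mathcal{O}_1=f$; with batch size $b$, oracle $\mathcal{O}_i$ answers the $i$-th batch of $b$ queries. After each batch the adversary chooses the next oracle; its strategy may depend on the input, the tester's description, and all queries made so far, but not on the tester's future coin tosses. Let $\mathrm{Dist}$ denote Hamming distance (number of points with different answers). A $t$-online budget-managing adversary must satisfy $\mathrm{Dist}(\mathcal{O}_1,\mathcal{O}_{i+1})\le i\cdot t$ for all $i\in\mathbb{N}$. An erasure adversary must satisfy $\mathcal{O}_{i+1}(x)\in\{\mathcal{O}_i(x),\perp\}$ for all $x$ ($\perp$ is the erasure symbol); a corruption adversary may change values arbitrarily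 within the range. Query complexity counts the total number of individual queries. $f$ is $\varepsilon$-far from $\mathcal{P}$ if at least an $\varepsilon$ fraction of the values of $f$ must be changed to obtain a sequence in $\mathcal{P}$. An (online) $\varepsilon$-tester for $\mathcal{P}$ working in the presence of a given type of adversary is a randomized algorithm that, for every adversarial strategy of that type, accepts with probability at least $2/3$ if $f\in\mathcal{P}$ and rejects with probability at least $2/3$ if $f$ is $\varepsilon$-far from $\mathcal{P}$. It has one-sided error if it always accepts every $f\in\mathcal{P}$.
   Formalization: log(εn) is read as max(1, log₂(εn)) both in the bound on t and in the query bound, since at εn = 1 the bound on t is undefined and for εn near or below 1 the literal query bound is below one or negative; and n ≥ 1 is assumed. *)

theory Defs
  imports "HOL-Probability.Probability"
begin

text \<open>Sequences \<open>f: [n] \<rightarrow> \<real>\<close>, indexed from 1.\<close>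

definition seqs :: "nat \<Rightarrow> (nat \<Rightarrow> real) set" where
  "seqs n = ({1..n} \<rightarrow>\<^sub>E UNIV)"

definition local_property :: "nat \<Rightarrow> (nat \<Rightarrow> real) set \<Rightarrow> bool" where
  "local_property n P \<longleftrightarrow>
     (\<exists>F :: (real \<times> real) set. P = {f \<in> seqs n. \<forall>i\<in>{1..<n}. (f i, f (i + 1)) \<notin> F})"

definition Dist :: "nat \<Rightarrow> (nat \<Rightarrow> 'a) \<Rightarrow> (nat \<Rightarrow> 'a) \<Rightarrow> nat" where
  "Dist n g h = card {x \<in> {1..n}. g x \<noteq> h x}"

text \<open>If \<open>P\<close> is empty, every sequence is far from it.\<close>

definition far_from :: "nat \<Rightarrow> real \<Rightarrow> (nat \<Rightarrow> real) set \<Rightarrow> (nat \<Rightarrow> real) \<Rightarrow> bool" where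
  "far_from n \<epsilon> P f \<longleftrightarrow> (\<forall>g\<in>P. real (Dist n f g) \<ge> \<epsilon> * real n)"

text \<open>Oracles: the answer is \<open>None\<close> at an erased point.\<close>

type_synonym answer_fun = "nat \<Rightarrow> real option"

text \<open>
  A randomized adaptive algorithm, as a tree: it halts with a verdict (\<open>True\<close> means accept),
  submits a batch of queries and continues depending on the list of answers, or tosses coins.
  Every branch is finite.
\<close>

datatype tester =
    Decide bool
  | Batch "nat list" "real option list \<Rightarrow> tester"
  | Toss "tester pmf"

text \<open>
  The strategy of an adversary maps the list of the batches submitted so far (oldest first) to the
  oracle that answers the next batch. Thus after the batches \<open>x\<^sub>1, \<dots>, x\<^sub>i\<close> the oracle number
  \<open>i + 1\<close> is \<open>A [x\<^sub>1, \<dots>, x\<^sub>i]\<close>; the adversary sees the coin tosses of the tester only through these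
  queries. Strategies are chosen after the tester and the input, so they may depend on both.
\<close>

type_synonym adversary = "nat list list \<Rightarrow> answer_fun"

text \<open>Distribution of the verdict when the batches \<open>h\<close> have already been submitted.\<close>

primrec run :: "tester \<Rightarrow> adversary \<Rightarrow> nat list list \<Rightarrow> bool pmf" where
  "run (Decide v) A h = return_pmf v"
| "run (Batch xs k) A h = run (k (map (A h) xs)) A (h @ [xs])"
| "run (Toss p) A h = join_pmf (map_pmf (\<lambda>T. run T A h) p)"

inductive has_batch_size :: "nat \<Rightarrow> nat \<Rightarrow> tester \<Rightarrow> bool" for n b where
  "has_batch_size n b (Decide v)"
| "length xs = b \<Longrightarrow> set xs \<subseteq> {1..n} \<Longrightarrow> (\<forall>as. has_batch_size n b (k as)) \<Longrightarrow>
     has_batch_size n b (Batch xs k)"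
| "(\<forall>T\<in>set_pmf p. has_batch_size n b T) \<Longrightarrow> has_batch_size n b (Toss p)"

text \<open>At most \<open>q\<close> individual queries in every execution, for all coin tosses and all answers.\<close>

inductive makes_at_most :: "nat \<Rightarrow> tester \<Rightarrow> bool" where
  "makes_at_most q (Decide v)"
| "(\<forall>as. makes_at_most q (k as)) \<Longrightarrow> makes_at_most (length xs + q) (Batch xs k)"
| "(\<forall>T\<in>set_pmf p. makes_at_most q T) \<Longrightarrow> makes_at_most q (Toss p)"

definition budget_managing :: "nat \<Rightarrow> real \<Rightarrow> (nat \<Rightarrow> real) \<Rightarrow> adversary \<Rightarrow> bool" where
  "budget_managing n t f A \<longleftrightarrow>
     (\<forall>x\<in>{1..n}. A [] x = Some (f x)) \<and>
     (\<forall>h. real (Dist n (A []) (A h)) \<le> real (length h) * t)"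

definition erasure_adversary :: "nat \<Rightarrow> real \<Rightarrow> (nat \<Rightarrow> real) \<Rightarrow> adversary \<Rightarrow> bool" where
  "erasure_adversary n t f A \<longleftrightarrow> budget_managing n t f A \<and>
     (\<forall>h xs. \<forall>x\<in>{1..n}. A (h @ [xs]) x \<in> {A h x, None})"

definition corruption_adversary :: "nat \<Rightarrow> real \<Rightarrow> (nat \<Rightarrow> real) \<Rightarrow> adversary \<Rightarrow> bool" where
  "corruption_adversary n t f A \<longleftrightarrow> budget_managing n t f A \<and>
     (\<forall>h. \<forall>x\<in>{1..n}. A h x \<noteq> None)"

text \<open>\<open>Adv f A\<close> says that \<open>A\<close> is an admissible strategy on input \<open>f\<close>.\<close>

definition is_tester ::
    "nat \<Rightarrow> real \<Rightarrow> (nat \<Rightarrow> real) set \<Rightarrow> ((nat \<Rightarrow> real) \<Rightarrow> adversary \<Rightarrow> bool) \<Rightarrow> tester \<Rightarrow> bool" where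
  "is_tester n \<epsilon> P Adv T \<longleftrightarrow>
     (\<forall>f\<in>seqs n. \<forall>A. Adv f A \<longrightarrow>
        (f \<in> P \<longrightarrow> pmf (run T A []) True \<ge> 2 / 3) \<and>
        (far_from n \<epsilon> P f \<longrightarrow> pmf (run T A []) False \<ge> 2 / 3))"

definition one_sided ::
    "(nat \<Rightarrow> real) set \<Rightarrow> ((nat \<Rightarrow> real) \<Rightarrow> adversary \<Rightarrow> bool) \<Rightarrow> tester \<Rightarrow> bool" where
  "one_sided P Adv T \<longleftrightarrow> (\<forall>f\<in>P. \<forall>A. Adv f A \<longrightarrow> pmf (run T A []) True = 1)"

text \<open>
  The base-2 logarithm, with the usual convention that logarithms in asymptotic bounds are at
  least 1. It is needed at arguments below 2: with the plain logarithm, the bound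
  \<open>c * \<epsilon>\<^sup>2 * n / (log 2 (\<epsilon> * n))\<^sup>2\<close> is unbounded and \<open>log 2 (\<epsilon> * n) / \<epsilon>\<close> vanishes as
  \<open>\<epsilon> * n\<close> tends to 1.
\<close>

definition lg :: "real \<Rightarrow> real" where
  "lg x = max 1 (log 2 x)"

end

theory Submission
  imports Defs
begin

text \<open>
  The tester repeatedly picks a random scale \<open>2 ^ j\<close> with \<open>2 ^ j \<le> \<epsilon> * n / 4\<close> and a random \<open>x\<close>, and
  queries \<open>x\<close> and \<open>x + 2 ^ j\<close> in one batch; it rejects if no member of the property takes both
  observed values. For a fixed shift, split \<open>[n]\<close> into blocks of the largest scale and each block
  dyadically. If no block has incompatible endpoints, then rewriting the interiors of the maximal
  dyadic intervals with compatible endpoints but an incompatible half, as well as the two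
  incomplete blocks at the ends, puts \<open>f\<close> into the property. Hence for \<open>\<epsilon>\<close>-far \<open>f\<close> the incompatible
  dyadic intervals have total length of order \<open>\<epsilon> * n\<close>; averaging over all shifts, a random pair is
  incompatible with probability of order \<open>\<epsilon> / lg (\<epsilon> * n)\<close>. Every position is queried with
  probability at most \<open>2 / n\<close> per batch, so under the bound on \<open>t\<close> the tester is unlikely ever to
  see a point that the adversary has modified.
\<close>

section \<open>Repairing intervals with fixed endpoint values\<close>

text \<open>Quantifying over \<open>P\<close> instead of the forbidden pairs makes sense at any
  distance and depends only on \<open>f x\<close> and \<open>f y\<close>, so two answers decide
  it.\<close>

definition incompatible :: "(nat \<Rightarrow> real) set \<Rightarrow> (nat \<Rightarrow> real) \<Rightarrow> nat \<Rightarrow> nat \<Rightarrow> bool" where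
  "incompatible P f x y \<longleftrightarrow> \<not> (\<exists>g\<in>P. g x = f x \<and> g y = f y)"

text \<open>The endpoint values stay fixed so that repairs of adjacent intervals can be
  glued.\<close>

definition repairable ::
    "(real \<times> real) set \<Rightarrow> (nat \<Rightarrow> real) \<Rightarrow> nat \<Rightarrow> nat \<Rightarrow> nat \<Rightarrow> bool" where
  "repairable F f a b c \<longleftrightarrow>
     (\<exists>g. g a = f a \<and> g b = f b \<and> (\<forall>i\<in>{a..<b}. (g i, g (i + 1)) \<notin> F) \<and>
          card {x\<in>{a..b}. g x \<noteq> f x} \<le> c)"

text \<open>This is the total length of the incompatible intervals in the binary tree of dyadic
  subintervals of \<open>[a, a + 2 ^ j]\<close>, nested ones all counted.\<close>

primrec dyadic_weight :: "(nat \<Rightarrow> real) set \<Rightarrow> (nat \<Rightarrow> real) \<Rightarrow> nat \<Rightarrow> nat \<Rightarrow> nat" where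
  "dyadic_weight P f 0 a = (if incompatible P f a (a + 1) then 1 else 0)"
| "dyadic_weight P f (Suc j) a = (if incompatible P f a (a + 2 ^ Suc j) then 2 ^ Suc j else 0) +
     (dyadic_weight P f j a + dyadic_weight P f j (a + 2 ^ j))"

lemma dyadic_weight_ge:
  assumes "incompatible P f a (a + 2 ^ j)"
  shows "2 ^ j \<le> dyadic_weight P f j a"
  using assms by (cases j) auto

lemma repairable_refl: "repairable F f a a 0"
  unfolding repairable_def by (rule exI[of _ f]) auto

text \<open>Both repairs keep \<open>f b\<close>, so every consecutive pair of the glued sequence
  comes from one of them, and the numbers of changes add up.\<close>

lemma repairable_trans:
  assumes "repairable F f a b c" "repairable F f b d c'" "a \<le> b" "b \<le> d"
  shows "repairable F f a d (c + c')"
proof -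
  obtain g where g: "g a = f a" "g b = f b" "\<forall>i\<in>{a..<b}. (g i, g (i + 1)) \<notin> F"
      "card {x\<in>{a..b}. g x \<noteq> f x} \<le> c"
    using assms(1) unfolding repairable_def by blast
  obtain g' where g': "g' b = f b" "g' d = f d" "\<forall>i\<in>{b..<d}. (g' i, g' (i + 1)) \<notin> F"
      "card {x\<in>{b..d}. g' x \<noteq> f x} \<le> c'"
    using assms(2) unfolding repairable_def by blast
  define r where "r = (\<lambda>i. if i \<le> b then g i else g' i)"
  have "(r i, r (i + 1)) \<notin> F" if "i \<in> {a..<d}" for i
  proof (cases "i < b")
    case True
    then show ?thesis using g(3) that by (auto simp: r_def)
  next
    case False
    then have "r i = g' i" "r (i + 1) = g' (i + 1)"
      using g(2) g'(1) by (auto simp: r_def)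
    then show ?thesis using g'(3) that False by auto
  qed
  moreover have "card {x\<in>{a..d}. r x \<noteq> f x} \<le> c + c'"
  proof -
    have "{x\<in>{a..d}. r x \<noteq> f x} \<subseteq> {x\<in>{a..b}. g x \<noteq> f x} \<union> {x\<in>{b..d}. g' x \<noteq> f x}"
      by (auto simp: r_def)
    then have "card {x\<in>{a..d}. r x \<noteq> f x} \<le>
        card ({x\<in>{a..b}. g x \<noteq> f x} \<union> {x\<in>{b..d}. g' x \<noteq> f x})"
      by (intro card_mono) auto
    also have "\<dots> \<le> card {x\<in>{a..b}. g x \<noteq> f x} + card {x\<in>{b..d}. g' x \<noteq> f x}"
      by (rule card_Un_le)
    finally show ?thesis using g(4) g'(4) by linarith
  qed
  moreover have "r a = f a" "r d = f d"
    using g g' assms(3,4) by (auto simp: r_def)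
  ultimately show ?thesis
    unfolding repairable_def by blast
qed

text \<open>If a half of the interval is incompatible, then its length pays for rewriting the whole
  interior; otherwise the two halves are repaired separately.\<close>

lemma dyadic_repair:
  assumes P: "P = {f \<in> seqs n. \<forall>i\<in>{1..<n}. (f i, f (i + 1)) \<notin> F}"
    and "1 \<le> a" "a + 2 ^ j \<le> n" "\<not> incompatible P f a (a + 2 ^ j)"
  shows "repairable F f a (a + 2 ^ j) (2 * dyadic_weight P f j a)"
  using assms(2-)
proof (induction j arbitrary: a)
  case 0
  then obtain g where "g \<in> P" "g a = f a" "g (a + 1) = f (a + 1)"
    by (auto simp: incompatible_def)
  then have "(f a, f (a + 1)) \<notin> F"
    using 0 unfolding P by force
  then show ?case
    unfolding repairable_def by (intro exI[of _ f]) auto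
next
  case (Suc j)
  let ?b = "a + 2 ^ j" and ?d = "a + 2 ^ Suc j"
  have d: "?d = ?b + 2 ^ j" by simp
  show ?case
  proof (cases "incompatible P f a ?b \<or> incompatible P f ?b ?d")
    case False
    have "repairable F f a ?b (2 * dyadic_weight P f j a)"
      using Suc False by auto
    moreover have "repairable F f ?b ?d (2 * dyadic_weight P f j ?b)"
      using Suc.prems False by (intro Suc.IH[of ?b, folded d]) auto
    ultimately have "repairable F f a ?d (2 * dyadic_weight P f j a + 2 * dyadic_weight P f j ?b)"
      by (rule repairable_trans) auto
    moreover have "2 * dyadic_weight P f (Suc j) a = 2 * dyadic_weight P f j a + 2 * dyadic_weight P f j ?b"
      using Suc.prems(3) by simp
    ultimately show ?thesis by simp
  next
    case True
    \<comment> \<open>An incompatible half weighs at least \<open>2 ^ j\<close>; twice that exceeds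
      the \<open>2 ^ Suc j - 1\<close> interior positions. Hence the factor 2 in the cost.\<close>
    then have w: "2 ^ Suc j \<le> 2 * dyadic_weight P f (Suc j) a"
      using dyadic_weight_ge[of P f a j] dyadic_weight_ge[of P f ?b j, folded d] by auto
    obtain g where g: "g \<in> P" "g a = f a" "g ?d = f ?d"
      using Suc.prems(3) unfolding incompatible_def by blast
    have "{x\<in>{a..?d}. g x \<noteq> f x} \<subseteq> {a<..<?d}"
    proof
      fix x assume x: "x \<in> {x\<in>{a..?d}. g x \<noteq> f x}"
      then have "x \<noteq> a" "x \<noteq> ?d" using g by blast+
      then show "x \<in> {a<..<?d}" using x by simp
    qed
    then have "card {x\<in>{a..?d}. g x \<noteq> f x} \<le> card {a<..<?d}"
      by (intro card_mono) auto
    also have "\<dots> \<le> 2 * dyadic_weight P f (Suc j) a"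
      using w by (simp only: card_greaterThanLessThan)
    finally have "card {x\<in>{a..?d}. g x \<noteq> f x} \<le> 2 * dyadic_weight P f (Suc j) a" .
    moreover have "\<forall>i\<in>{a..<?d}. (g i, g (i + 1)) \<notin> F"
      using g(1) Suc.prems unfolding P by auto
    ultimately show ?thesis
      unfolding repairable_def using g by blast
  qed
qed

text \<open>Neighbouring blocks share an endpoint that their repairs leave unchanged, so the repairs
  concatenate.\<close>

lemma grid_repair:
  assumes P: "P = {f \<in> seqs n. \<forall>i\<in>{1..<n}. (f i, f (i + 1)) \<notin> F}"
    and "1 \<le> s" "s + k * 2 ^ m \<le> n"
    and "\<And>i. i < k \<Longrightarrow> \<not> incompatible P f (s + i * 2 ^ m) (s + i * 2 ^ m + 2 ^ m)"
  shows "repairable F f s (s + k * 2 ^ m) (2 * (\<Sum>i<k. dyadic_weight P f m (s + i * 2 ^ m)))"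
  using assms(3,4)
proof (induction k)
  case 0
  then show ?case using repairable_refl by simp
next
  case (Suc k)
  let ?b = "s + k * 2 ^ m"
  have e: "s + Suc k * 2 ^ m = ?b + 2 ^ m" by simp
  have "repairable F f s ?b (2 * (\<Sum>i<k. dyadic_weight P f m (s + i * 2 ^ m)))"
    using Suc by auto
  moreover have "repairable F f ?b (?b + 2 ^ m) (2 * dyadic_weight P f m ?b)"
    using Suc.prems assms(2) by (intro dyadic_repair[OF P]) auto
  ultimately have "repairable F f s (?b + 2 ^ m)
      (2 * (\<Sum>i<k. dyadic_weight P f m (s + i * 2 ^ m)) + 2 * dyadic_weight P f m ?b)"
    by (rule repairable_trans) auto
  then show ?case
    unfolding e by (simp only: sum.lessThan_Suc distrib_left)
qed

section \<open>Far sequences have many incompatible dyadic pairs\<close>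

text \<open>A single incompatible block already weighs \<open>2 ^ m > \<epsilon> * n / 8\<close>. If
  all blocks are compatible, \<open>f\<close> can be repaired at cost twice the weight plus at most
  \<open>2 * 2 ^ m \<le> \<epsilon> * n / 2\<close> for the two ends, so farness forces weight at
  least \<open>\<epsilon> * n / 4\<close>.\<close>

lemma far_grid_weight:
  assumes P: "P = {f \<in> seqs n. \<forall>i\<in>{1..<n}. (f i, f (i + 1)) \<notin> F}"
    and far: "far_from n \<epsilon> P f"
    and m: "2 ^ m \<le> \<epsilon> * n / 4" "\<epsilon> * n / 4 < 2 ^ Suc m"
    and s: "1 \<le> s" "s \<le> 2 ^ m" "s + 2 ^ m \<le> n"
  shows "\<epsilon> * n / 8 \<le> real (\<Sum>i<(n - s) div 2 ^ m. dyadic_weight P f m (s + i * 2 ^ m))"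
proof -
  define l :: nat where "l = 2 ^ m"
  define k where "k = (n - s) div l"
  define e where "e = s + k * l"
  let ?W = "\<Sum>i<k. dyadic_weight P f m (s + i * l)"
  have l: "0 < l" by (simp add: l_def)
  \<comment> \<open>At least one whole block fits, so both \<open>s\<close> and \<open>e\<close> are
    endpoints of blocks.\<close>
  have "l div l \<le> k"
    unfolding k_def using s(3) by (intro div_le_mono) (simp add: l_def)
  then have k: "1 \<le> k" using l by simp
  have e: "e \<le> n" "n < e + l"
  proof -
    have "n - s = k * l + (n - s) mod l" unfolding k_def by simp
    moreover have "(n - s) mod l < l" using l by simp
    ultimately show "e \<le> n" "n < e + l" unfolding e_def using s(3) by linarith+
  qed
  have rl: "real l = 2 ^ m" by (simp add: l_def)
  have "\<epsilon> * n / 8 \<le> real ?W"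
  proof (cases "\<exists>i<k. incompatible P f (s + i * l) (s + i * l + l)")
    case True
    then obtain i where i: "i < k" "incompatible P f (s + i * l) (s + i * l + l)" by blast
    have "l \<le> dyadic_weight P f m (s + i * l)"
      using dyadic_weight_ge i(2) by (simp add: l_def)
    also have "\<dots> \<le> ?W"
      using i(1) by (intro member_le_sum) auto
    finally have "real l \<le> real ?W" by (simp only: of_nat_le_iff)
    then show ?thesis using m(2) rl by simp
  next
    case False
    then have compat: "\<not> incompatible P f (s + i * l) (s + i * l + l)" if "i < k" for i
      using that by blast
    have "repairable F f s e (2 * ?W)"
      unfolding e_def l_def
      using compat s(1) e(1) by (intro grid_repair[OF P]) (simp_all add: l_def e_def)
    then obtain g where g: "g s = f s" "g e = f e" "\<forall>i\<in>{s..<e}. (g i, g (i + 1)) \<notin> F"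
        "card {x\<in>{s..e}. g x \<noteq> f x} \<le> 2 * ?W"
      unfolding repairable_def by blast
    \<comment> \<open>Compatibility of the first block gives a member of \<open>P\<close> through
      \<open>f s\<close>, that of the last block one through \<open>f e\<close>. Their outer parts
      continue the repair down to 1 and up to \<open>n\<close>.\<close>
    obtain u where u: "u \<in> P" "u s = f s"
      using compat[of 0] k unfolding incompatible_def by auto
    have "s + (k - 1) * l + l = e"
      unfolding e_def using k by (cases k) auto
    then have "\<not> incompatible P f (s + (k - 1) * l) e"
      using compat[of "k - 1"] k by simp
    then obtain v where v: "v \<in> P" "v e = f e"
      unfolding incompatible_def by blast
    have se: "s \<le> e" by (simp add: e_def)
    define r where "r = (\<lambda>i. if i < s then u i else if i \<le> e then g i else v i)"
    have "r \<in> seqs n"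
      using u(1) v(1) s(1) e unfolding P seqs_def r_def by (auto simp: PiE_iff extensional_def)
    moreover have "(r i, r (i + 1)) \<notin> F" if i: "i \<in> {1..<n}" for i
    proof -
      consider "i < s" | "s \<le> i" "i < e" | "e \<le> i" by linarith
      then show ?thesis
      proof cases
        case 1
        then have "r i = u i" "r (i + 1) = u (i + 1)"
          using g(1) u(2) se by (auto simp: r_def not_less le_Suc_eq Suc_le_eq intro: less_antisym)
        then show ?thesis using u(1) i unfolding P by auto
      next
        case 2
        then show ?thesis using g(3) by (auto simp: r_def)
      next
        case 3
        then have "r i = v i" "r (i + 1) = v (i + 1)"
          using g(2) v(2) se by (auto simp: r_def)
        then show ?thesis using v(1) i unfolding P by auto
      qed
    qed
    ultimately have "r \<in> P" unfolding P by blast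
    then have "\<epsilon> * n \<le> real (Dist n f r)"
      using far unfolding far_from_def by blast
    \<comment> \<open>The left end has \<open>s - 1 < l\<close> positions because
      \<open>s \<le> 2 ^ m\<close>, the right end \<open>n - e < l\<close>.\<close>
    moreover have "Dist n f r \<le> l + 2 * ?W + l"
    proof -
      have "{x \<in> {1..n}. f x \<noteq> r x} \<subseteq> {1..<s} \<union> {x\<in>{s..e}. g x \<noteq> f x} \<union> {e<..n}"
        by (auto simp: r_def)
      then have "Dist n f r \<le> card ({1..<s} \<union> {x\<in>{s..e}. g x \<noteq> f x} \<union> {e<..n})"
        unfolding Dist_def by (intro card_mono) auto
      also have "\<dots> \<le> card {1..<s} + card {x\<in>{s..e}. g x \<noteq> f x} + card {e<..n}"
        by (meson card_Un_le add_le_mono1 order_trans)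
      also have "\<dots> \<le> l + 2 * ?W + l"
        using g(4) s(2) e by (intro add_mono) (auto simp: l_def)
      finally show ?thesis .
    qed
    ultimately have "\<epsilon> * n \<le> real (l + 2 * ?W + l)" by linarith
    then have "\<epsilon> * n \<le> 2 * real l + 2 * real ?W"
      by (simp only: of_nat_add of_nat_mult of_nat_numeral)
    moreover have "0 \<le> \<epsilon> * n" using m(1) zero_le_power[of "2::real" m] by linarith
    ultimately show ?thesis using m(1) rl by linarith
  qed
  then show ?thesis by (simp add: k_def l_def)
qed

text \<open>Double counting: an incompatible interval of length \<open>2 ^ i\<close> lies in the
  trees of at most \<open>2 ^ (j - i)\<close> roots \<open>x\<close> and contributes
  \<open>2 ^ i\<close> to each, hence at most \<open>2 ^ j\<close> in all.\<close>

lemma sum_dyadic_weight_le: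
  "(\<Sum>x\<in>{1..n - 2 ^ j}. dyadic_weight P f j x) \<le>
     2 ^ j * (\<Sum>i\<le>j. card {x\<in>{1..n}. x + 2 ^ i \<le> n \<and> incompatible P f x (x + 2 ^ i)})"
proof (induction j)
  case 0
  have "(\<Sum>x\<in>{1..n - 2 ^ 0}. dyadic_weight P f 0 x) =
      card {x\<in>{1..n - 1}. incompatible P f x (x + 1)}"
    by (simp add: sum.If_cases Int_def)
  also have "\<dots> \<le> card {x\<in>{1..n}. x + 1 \<le> n \<and> incompatible P f x (x + 1)}"
    by (intro card_mono) auto
  finally show ?case by simp
next
  case (Suc j)
  let ?B = "\<lambda>i. {x\<in>{1..n}. x + 2 ^ i \<le> n \<and> incompatible P f x (x + 2 ^ i)}"
  let ?S = "{1..n - 2 ^ Suc j}"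
  have "(\<Sum>x\<in>?S. if incompatible P f x (x + 2 ^ Suc j) then 2 ^ Suc j else 0) =
      2 ^ Suc j * card {x\<in>?S. incompatible P f x (x + 2 ^ Suc j)}"
    by (simp add: sum.If_cases Int_def)
  also have "\<dots> \<le> 2 ^ Suc j * card (?B (Suc j))"
    by (intro mult_left_mono card_mono) auto
  finally have 1: "(\<Sum>x\<in>?S. if incompatible P f x (x + 2 ^ Suc j) then 2 ^ Suc j else 0) \<le>
      2 ^ Suc j * card (?B (Suc j))" .
  \<comment> \<open>Left halves, and likewise right halves, have distinct starting points and stay
    inside \<open>[n]\<close>, so each of the two sums is at most the full sum one level
    below.\<close>
  have 2: "(\<Sum>x\<in>?S. dyadic_weight P f j x) \<le> (\<Sum>x\<in>{1..n - 2 ^ j}. dyadic_weight P f j x)"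
    by (intro sum_mono2) auto
  have "(\<Sum>x\<in>?S. dyadic_weight P f j (x + 2 ^ j)) = (\<Sum>x\<in>(\<lambda>x. x + 2 ^ j) ` ?S. dyadic_weight P f j x)"
    by (subst sum.reindex) auto
  also have "\<dots> \<le> (\<Sum>x\<in>{1..n - 2 ^ j}. dyadic_weight P f j x)"
    by (intro sum_mono2) auto
  finally have 3: "(\<Sum>x\<in>?S. dyadic_weight P f j (x + 2 ^ j)) \<le> (\<Sum>x\<in>{1..n - 2 ^ j}. dyadic_weight P f j x)" .
  have "(\<Sum>x\<in>?S. dyadic_weight P f (Suc j) x) =
      (\<Sum>x\<in>?S. if incompatible P f x (x + 2 ^ Suc j) then 2 ^ Suc j else 0) +
      ((\<Sum>x\<in>?S. dyadic_weight P f j x) + (\<Sum>x\<in>?S. dyadic_weight P f j (x + 2 ^ j)))"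
    by (simp only: dyadic_weight.simps sum.distrib)
  also have "\<dots> \<le> 2 ^ Suc j * card (?B (Suc j)) + 2 * (2 ^ j * (\<Sum>i\<le>j. card (?B i)))"
    using 1 2 3 Suc.IH by linarith
  also have "\<dots> = 2 ^ Suc j * (\<Sum>i\<le>Suc j. card (?B i))"
    by (simp add: algebra_simps)
  finally show ?case .
qed

text \<open>Summing \<open>far_grid_weight\<close> over all shifts \<open>s\<close> makes the starting points of the grid
  intervals run through each position at most once, which removes the dependence on \<open>s\<close>.\<close>

lemma far_many_incompatible_large:
  assumes P: "P = {f \<in> seqs n. \<forall>i\<in>{1..<n}. (f i, f (i + 1)) \<notin> F}"
    and far: "far_from n \<epsilon> P f" and eps: "\<epsilon> < 1"
    and m: "2 ^ m \<le> \<epsilon> * n / 4" "\<epsilon> * n / 4 < 2 ^ Suc m"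
  shows "\<epsilon> * n / 8 \<le>
    real (\<Sum>i\<le>m. card {x\<in>{1..n}. x + 2 ^ i \<le> n \<and> incompatible P f x (x + 2 ^ i)})"
    (is "_ \<le> real ?B")
proof -
  define l :: nat where "l = 2 ^ m"
  define k where "k = (\<lambda>s. (n - s) div l)"
  define w where "w = dyadic_weight P f m"
  have l: "0 < l" "real l = 2 ^ m" by (simp_all add: l_def)
  \<comment> \<open>From \<open>\<epsilon> < 1\<close> follows \<open>2 * l \<le> n\<close>: every
    shift \<open>s \<le> l\<close> leaves room for a whole block.\<close>
  have "\<epsilon> * n \<le> 1 * real n" using eps by (intro mult_right_mono) auto
  then have "2 * real l \<le> n" using m(1) l by linarith
  then have ln: "2 * l \<le> n" by linarith
  let ?I = "SIGMA s:{1..l}. {..<k s}"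
  have "inj_on (\<lambda>(s, i). s + i * l) ?I"
  proof (rule inj_onI)
    fix z z' assume "z \<in> ?I" "z' \<in> ?I" "(\<lambda>(s, i). s + i * l) z = (\<lambda>(s, i). s + i * l) z'"
    then obtain s i s' i' where z: "z = (s, i)" "z' = (s', i')"
      and *: "s \<in> {1..l}" "s' \<in> {1..l}" "s + i * l = s' + i' * l"
      by auto
    \<comment> \<open>Shifts start at 1, so the remainder modulo \<open>l\<close> is
      \<open>s - 1\<close>, and dividing \<open>s - 1 + i * l\<close> by \<open>l\<close> recovers
      \<open>i\<close>.\<close>
    have div: "(a + j * l) div l = j" if "a < l" for a j
      using that by simp
    have "(s - 1 + i * l) div l = i" "(s' - 1 + i' * l) div l = i'"
      using * by (intro div; simp; linarith)+
    moreover have "s - 1 + i * l = s' - 1 + i' * l"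
      using * by auto
    ultimately have "i = i'" by metis
    then show "z = z'" using * z by simp
  qed
  then have "(\<Sum>(s, i)\<in>?I. w (s + i * l)) = (\<Sum>x\<in>(\<lambda>(s, i). s + i * l) ` ?I. w x)"
    by (subst sum.reindex) (auto simp: case_prod_beta intro!: sum.cong)
  also have "\<dots> \<le> (\<Sum>x\<in>{1..n - l}. w x)"
  proof (intro sum_mono2)
    show "(\<lambda>(s, i). s + i * l) ` ?I \<subseteq> {1..n - l}"
    proof
      fix x assume "x \<in> (\<lambda>(s, i). s + i * l) ` ?I"
      then obtain s i where x: "x = s + i * l" and *: "s \<in> {1..l}" "i \<in> {..<k s}"
        by auto
      have "Suc i * l \<le> k s * l" using * by (intro mult_right_mono) auto
      also have "\<dots> \<le> n - s" by (simp add: k_def)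
      finally have "s + i * l + l \<le> n" using * ln by auto
      then show "x \<in> {1..n - l}" using * x by auto
    qed
  qed auto
  also have "\<dots> \<le> l * ?B"
    using sum_dyadic_weight_le unfolding w_def l_def by blast
  finally have "(\<Sum>s\<in>{1..l}. \<Sum>i<k s. w (s + i * l)) \<le> l * ?B"
    by (subst sum.Sigma) auto
  then have "real (\<Sum>s\<in>{1..l}. \<Sum>i<k s. w (s + i * l)) \<le> real (l * ?B)"
    by (simp only: of_nat_le_iff)
  moreover have "(\<Sum>s\<in>{1..l}. \<epsilon> * n / 8) \<le> (\<Sum>s\<in>{1..l}. real (\<Sum>i<k s. w (s + i * l)))"
    using far_grid_weight[OF P far m] ln
    by (intro sum_mono) (auto simp: k_def w_def l_def)
  \<comment> \<open>The number \<open>l\<close> of shifts cancels against the factor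
    \<open>2 ^ m\<close> from \<open>sum_dyadic_weight_le\<close>.\<close>
  ultimately have "real l * (\<epsilon> * n / 8) \<le> real l * real ?B"
    by (simp only: of_nat_sum of_nat_mult sum_constant card_atLeastAtMost) simp
  then show ?thesis using l by (simp only: mult_le_cancel_left_pos of_nat_0_less_iff)
qed

text \<open>When \<open>\<epsilon> * n < 8\<close>, scale 0 suffices: a far \<open>f\<close> is not
  in \<open>P\<close>, and a single forbidden adjacent pair already exceeds
  \<open>\<epsilon> * n / 8\<close>.\<close>

lemma far_many_incompatible:
  assumes P: "P = {f \<in> seqs n. \<forall>i\<in>{1..<n}. (f i, f (i + 1)) \<notin> F}"
    and f: "f \<in> seqs n" and far: "far_from n \<epsilon> P f" and eps: "0 < \<epsilon>" "\<epsilon> < 1" and n: "1 \<le> n"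
    and m: "m = 0 \<and> \<epsilon> * n < 8 \<or> 2 ^ m \<le> \<epsilon> * n / 4 \<and> \<epsilon> * n / 4 < 2 ^ Suc m"
  shows "\<epsilon> * n / 8 \<le>
    real (\<Sum>i\<le>m. card {x\<in>{1..n}. x + 2 ^ i \<le> n \<and> incompatible P f x (x + 2 ^ i)})"
  using m
proof
  assume m: "m = 0 \<and> \<epsilon> * n < 8"
  have "f \<notin> P"
  proof
    assume "f \<in> P"
    then have "\<epsilon> * n \<le> real (Dist n f f)" using far unfolding far_from_def by blast
    then have "\<epsilon> * n \<le> 0" by (simp add: Dist_def)
    then show False using eps n by (simp add: mult_le_0_iff)
  qed
  then obtain i where i: "i \<in> {1..<n}" "(f i, f (i + 1)) \<in> F"
    using f unfolding P by blast
  then have "incompatible P f i (i + 1)"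
    unfolding P incompatible_def by force
  then have "card {i} \<le> card {x\<in>{1..n}. x + 1 \<le> n \<and> incompatible P f x (x + 1)}"
    using i by (intro card_mono) auto
  then show ?thesis using m by simp
next
  assume "2 ^ m \<le> \<epsilon> * n / 4 \<and> \<epsilon> * n / 4 < 2 ^ Suc m"
  then show ?thesis using far_many_incompatible_large[OF P far eps(2)] by blast
qed

section \<open>Distribution of the queried pair\<close>

text \<open>A pair that would leave \<open>[n]\<close> is replaced by the degenerate pair \<open>(x, x)\<close>, not truncated to
  \<open>(x, n)\<close>: no position may be queried with probability much larger than \<open>1 / n\<close>.\<close>

definition pair_pmf_dyadic :: "nat \<Rightarrow> nat \<Rightarrow> (nat \<times> nat) pmf" where
  "pair_pmf_dyadic n m =
     map_pmf (\<lambda>(j, x). (x, if x + 2 ^ j \<le> n then x + 2 ^ j else x)) (pmf_of_set ({..m} \<times> {1..n}))"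

lemma set_pair_pmf_dyadic:
  assumes "1 \<le> n" "(x, y) \<in> set_pmf (pair_pmf_dyadic n m)"
  shows "x \<in> {1..n}" "y \<in> {1..n}"
  using assms by (auto simp: pair_pmf_dyadic_def set_pmf_of_set split: if_splits)

lemma prob_pair_pmf_dyadic:
  assumes "1 \<le> n"
  shows "measure_pmf.prob (pair_pmf_dyadic n m) S =
    card {(j, x) \<in> {..m} \<times> {1..n}. (x, if x + 2 ^ j \<le> n then x + 2 ^ j else x) \<in> S} /
    (real (m + 1) * n)"
proof -
  have "({..m} \<times> {1..n}) \<inter> ((\<lambda>(j, x). (x, if x + 2 ^ j \<le> n then x + 2 ^ j else x)) -` S) =
     {(j, x) \<in> {..m} \<times> {1..n}. (x, if x + 2 ^ j \<le> n then x + 2 ^ j else x) \<in> S}"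
    by auto
  moreover have "{..m} \<times> {1..n} \<noteq> {}" using assms by auto
  ultimately show ?thesis
    unfolding pair_pmf_dyadic_def by (simp add: measure_pmf_of_set algebra_simps del: Sigma_empty_iff)
qed

text \<open>For each scale, a position of \<open>E\<close> is the first entry for one choice of
  \<open>x\<close> and the shifted entry for at most one. A degenerate pair meets \<open>E\<close>
  only through its first entry.\<close>

lemma prob_hit_le:
  assumes n: "1 \<le> n"
  shows "measure_pmf.prob (pair_pmf_dyadic n m) {(x, y). x \<in> E \<or> y \<in> E} \<le>
    2 * card (E \<inter> {1..n}) / n"
proof -
  let ?E = "E \<inter> {1..n}"
  let ?H = "{(j, x) \<in> {..m} \<times> {1..n}.
    (x, if x + 2 ^ j \<le> n then x + 2 ^ j else x) \<in> {(x, y). x \<in> E \<or> y \<in> E}}"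
  have "?H \<subseteq> {..m} \<times> ?E \<union> (\<lambda>(j, y). (j, y - 2 ^ j)) ` ({..m} \<times> ?E)"
  proof
    fix z assume "z \<in> ?H"
    then obtain j x where z: "z = (j, x)" and *: "j \<le> m" "x \<in> {1..n}"
      "x \<in> E \<or> (if x + 2 ^ j \<le> n then x + 2 ^ j else x) \<in> E"
      by blast
    show "z \<in> {..m} \<times> ?E \<union> (\<lambda>(j, y). (j, y - 2 ^ j)) ` ({..m} \<times> ?E)"
    proof (cases "x \<in> E")
      case True
      then show ?thesis using * z by simp
    next
      case False
      then have "(j, x + 2 ^ j) \<in> {..m} \<times> ?E" using * by (auto split: if_splits)
      then have "(\<lambda>(j, y). (j, y - 2 ^ j)) (j, x + 2 ^ j) \<in> (\<lambda>(j, y). (j, y - 2 ^ j)) ` ({..m} \<times> ?E)"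
        by (rule imageI)
      then show ?thesis using z by simp
    qed
  qed
  then have "card ?H \<le> card ({..m} \<times> ?E \<union> (\<lambda>(j, y). (j, y - 2 ^ j)) ` ({..m} \<times> ?E))"
    by (intro card_mono) auto
  also have "\<dots> \<le> card ({..m} \<times> ?E) + card ((\<lambda>(j, y). (j, y - 2 ^ j)) ` ({..m} \<times> ?E))"
    by (rule card_Un_le)
  also have "\<dots> \<le> card ({..m} \<times> ?E) + card ({..m} \<times> ?E)"
    by (intro add_left_mono card_image_le) auto
  also have "\<dots> = (m + 1) * (2 * card ?E)"
    by (simp add: card_cartesian_product)
  finally have "real (card ?H) \<le> real ((m + 1) * (2 * card ?E))"
    by (simp only: of_nat_le_iff)
  then have "real (card ?H) / (real (m + 1) * n) \<le> real ((m + 1) * (2 * card ?E)) / (real (m + 1) * n)"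
    by (intro divide_right_mono) auto
  also have "\<dots> = 2 * card ?E / n"
  proof -
    have "(w * z) / (w * y) = z / y" if "w \<noteq> 0" for w y z :: real
      using that by simp
    from this[of "real (m + 1)"] show ?thesis
      by (simp only: of_nat_mult of_nat_numeral)
  qed
  finally show ?thesis
    unfolding prob_pair_pmf_dyadic[OF n] .
qed

text \<open>Each counted pair comes from its own choice \<open>(j, x)\<close> among
  \<open>(m + 1) * n\<close> equally likely ones; degenerate pairs can only add to the
  probability.\<close>

lemma prob_incompatible_ge:
  assumes n: "1 \<le> n"
    and B: "\<epsilon> * n / 8 \<le>
      real (\<Sum>i\<le>m. card {x\<in>{1..n}. x + 2 ^ i \<le> n \<and> incompatible P f x (x + 2 ^ i)})"
  shows "\<epsilon> / (8 * real (m + 1)) \<le>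
    measure_pmf.prob (pair_pmf_dyadic n m) {(x, y). incompatible P f x y}"
proof -
  let ?B = "\<lambda>i. {x\<in>{1..n}. x + 2 ^ i \<le> n \<and> incompatible P f x (x + 2 ^ i)}"
  let ?H = "{(j, x) \<in> {..m} \<times> {1..n}.
    (x, if x + 2 ^ j \<le> n then x + 2 ^ j else x) \<in> {(x, y). incompatible P f x y}}"
  have "(\<Sum>i\<le>m. card (?B i)) = card (SIGMA i:{..m}. ?B i)"
    by (subst card_SigmaI) auto
  also have "\<dots> \<le> card ?H"
    by (intro card_mono finite_subset[of ?H "{..m} \<times> {1..n}"]) auto
  finally have "\<epsilon> * n / 8 \<le> card ?H" using B by linarith
  then have "\<epsilon> * n / 8 / (real (m + 1) * n) \<le> card ?H / (real (m + 1) * n)"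
    by (intro divide_right_mono) auto
  moreover have "\<epsilon> * n / 8 / (real (m + 1) * n) = \<epsilon> / (8 * real (m + 1))"
  proof -
    have "\<epsilon> * z / 8 / (w * z) = \<epsilon> / (8 * w)" if "z \<noteq> 0" for z w :: real
      using that by simp
    from this[of "real n" "real (m + 1)"] show ?thesis using n by simp
  qed
  ultimately show ?thesis
    unfolding prob_pair_pmf_dyadic[OF n] by (simp only: mem_Collect_eq case_prod_conv)
qed

section \<open>The tester and its rounds\<close>

text \<open>Counting erased answers as plausible is what yields one-sided error under erasures. On
  true values of \<open>f\<close> this is the negation of \<open>incompatible\<close>.\<close>

fun plausible :: "(nat \<Rightarrow> real) set \<Rightarrow> nat \<Rightarrow> nat \<Rightarrow> real option list \<Rightarrow> bool" where
  "plausible P x y [Some a, Some b] \<longleftrightarrow> (\<exists>g\<in>P. g x = a \<and> g y = b)"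
| "plausible P x y _ \<longleftrightarrow> True"

primrec pair_tester :: "(nat \<Rightarrow> real) set \<Rightarrow> (nat \<times> nat) pmf \<Rightarrow> nat \<Rightarrow> tester" where
  "pair_tester P D 0 = Decide True"
| "pair_tester P D (Suc k) = Toss (map_pmf (\<lambda>(x, y). Batch [x, y]
     (\<lambda>as. if plausible P x y as then pair_tester P D k else Decide False)) D)"

lemma has_batch_size_pair_tester:
  assumes "\<And>x y. (x, y) \<in> set_pmf D \<Longrightarrow> x \<in> {1..n} \<and> y \<in> {1..n}"
  shows "has_batch_size n 2 (pair_tester P D k)"
proof (induction k)
  case 0
  show ?case by (auto intro: has_batch_size.intros)
next
  case (Suc k)
  show ?case
    unfolding pair_tester.simps
  proof (rule has_batch_size.intros(3), clarsimp)
    fix x y assume "(x, y) \<in> set_pmf D"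
    then show "has_batch_size n 2 (Batch [x, y]
        (\<lambda>as. if plausible P x y as then pair_tester P D k else Decide False))"
      using assms Suc by (intro has_batch_size.intros) (auto intro: has_batch_size.intros)
  qed
qed

lemma makes_at_most_pair_tester: "makes_at_most (2 * k) (pair_tester P D k)"
proof (induction k)
  case 0
  show ?case by (auto intro: makes_at_most.intros)
next
  case (Suc k)
  have "makes_at_most (length [x, y] + 2 * k) (Batch [x, y]
      (\<lambda>as. if plausible P x y as then pair_tester P D k else Decide False))" for x y
    using Suc by (intro makes_at_most.intros) (auto intro: makes_at_most.intros)
  then show ?case
    unfolding pair_tester.simps by (intro makes_at_most.intros) auto
qed

text \<open>Merging the toss and the batch into one bind gives the form on which the inductions over
  rounds rest.\<close>

lemma run_pair_tester_Suc:
  "run (pair_tester P D (Suc k)) A h = bind_pmf D (\<lambda>(x, y).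
     if plausible P x y [A h x, A h y] then run (pair_tester P D k) A (h @ [[x, y]])
     else return_pmf False)"
  by (auto simp: pmf.map_comp bind_pmf_def[symmetric] o_def join_map_return_pmf
      join_eq_bind_pmf bind_map_pmf intro!: bind_pmf_cong)

lemma pmf_bool_sum: "pmf p True + pmf p False = 1" for p :: "bool pmf"
proof -
  have "sum (pmf p) UNIV = 1" by (rule sum_pmf_eq_1) auto
  then show ?thesis by (simp add: UNIV_bool add.commute)
qed

lemma integrable_pmf_bounded:
  fixes F :: "'a \<Rightarrow> real"
  assumes "\<And>z. \<bar>F z\<bar> \<le> B"
  shows "integrable (measure_pmf D) F"
  using assms by (intro measure_pmf.integrable_const_bound[of _ B]) auto

lemma integrable_pmf_indicator: "integrable (measure_pmf D) (indicat_real S)"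
  by (rule integrable_pmf_bounded[of _ 1]) (simp add: indicator_def)

section \<open>Error bounds against an adaptive adversary\<close>

text \<open>Erasures and corruptions are treated alike; outside this event a round sees the true
  values of \<open>f\<close>.\<close>

definition tampered :: "(nat \<Rightarrow> real) \<Rightarrow> answer_fun \<Rightarrow> (nat \<times> nat) set" where
  "tampered f a = {(x, y). a x \<noteq> Some (f x) \<or> a y \<noteq> Some (f y)}"

text \<open>The oracle \<open>A h\<close> is fixed before the next pair is drawn, so for each
  history a round survives with probability at most \<open>\<delta>\<close> from tampering plus
  \<open>1 - \<beta>\<close> times the bound for the remaining rounds. The bound \<open>q\<close> on
  all rounds makes \<open>hit\<close> available throughout.\<close>

lemma prob_accept_le:
  assumes hit: "\<And>h. length h < q \<Longrightarrow> measure_pmf.prob D (tampered f (A h)) \<le> \<delta>"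
    and \<beta>: "\<beta> \<le> measure_pmf.prob D {(x, y). incompatible P f x y}" "0 \<le> \<beta>"
    and \<delta>: "0 \<le> \<delta>"
    and "length h + k \<le> q"
  shows "pmf (run (pair_tester P D k) A h) True \<le> (1 - \<beta>) ^ k + k * \<delta>"
  using assms(5)
proof (induction k arbitrary: h)
  case 0
  show ?case by simp
next
  case (Suc k)
  let ?I = "{(x, y). incompatible P f x y}" and ?H = "tampered f (A h)"
  define u where "u = (1 - \<beta>) ^ k + k * \<delta>"
  have \<beta>1: "\<beta> \<le> 1" using \<beta>(1) measure_pmf.prob_le_1[of D ?I] by linarith
  have u: "0 \<le> u" using \<beta>1 \<delta> by (simp add: u_def)
  have "pmf (run (pair_tester P D (Suc k)) A h) True = (\<integral>z. pmf (case z of (x, y) \<Rightarrow>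
      if plausible P x y [A h x, A h y] then run (pair_tester P D k) A (h @ [[x, y]])
      else return_pmf False) True \<partial>D)"
    by (simp only: run_pair_tester_Suc pmf_bind)
  \<comment> \<open>Pointwise: a tampered pair is charged 1; any other pair continues only if
    compatible, and then the induction hypothesis gives \<open>u\<close>.\<close>
  also have "\<dots> \<le> (\<integral>z. indicat_real ?H z + indicat_real (- ?I) z * u \<partial>D)"
  proof (rule integral_mono)
    show "integrable (measure_pmf D) (\<lambda>z. pmf (case z of (x, y) \<Rightarrow>
      if plausible P x y [A h x, A h y] then run (pair_tester P D k) A (h @ [[x, y]])
      else return_pmf False) True)"
      by (rule integrable_pmf_bounded[of _ 1]) (simp add: pmf_le_1)
    show "integrable (measure_pmf D) (\<lambda>z. indicat_real ?H z + indicat_real (- ?I) z * u)"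
      by (rule integrable_pmf_bounded[of _ "1 + u"]) (use u in \<open>auto simp: indicator_def\<close>)
    fix z :: "nat \<times> nat"
    obtain x y where z: "z = (x, y)" by fastforce
    have IH: "pmf (run (pair_tester P D k) A (h @ [[x, y]])) True \<le> u"
      unfolding u_def using Suc.prems by (intro Suc.IH) simp
    show "pmf (case z of (x, y) \<Rightarrow>
      if plausible P x y [A h x, A h y] then run (pair_tester P D k) A (h @ [[x, y]])
      else return_pmf False) True \<le> indicat_real ?H z + indicat_real (- ?I) z * u"
    proof (cases "z \<in> ?H")
      case True
      have "pmf p True \<le> 1 + indicat_real (- ?I) z * u" for p
        using pmf_le_1[of p True] u by (simp add: add_increasing2)
      then show ?thesis using True by simp
    next
      case False
      then have "A h x = Some (f x)" "A h y = Some (f y)" by (auto simp: tampered_def z)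
      then show ?thesis
        using False IH u by (auto simp: z incompatible_def)
    qed
  qed
  also have "\<dots> = measure_pmf.prob D ?H + measure_pmf.prob D (- ?I) * u"
    by (simp add: integrable_pmf_indicator)
  also have "\<dots> = measure_pmf.prob D ?H + (1 - measure_pmf.prob D ?I) * u"
    using measure_pmf.prob_compl[of ?I D] by (simp add: Compl_eq_Diff_UNIV)
  also have "\<dots> \<le> \<delta> + (1 - \<beta>) * u"
    using hit[of h] Suc.prems \<beta> u by (intro add_mono mult_right_mono) auto
  also have "\<dots> = \<delta> + (1 - \<beta>) ^ Suc k + (1 - \<beta>) * (k * \<delta>)"
    by (simp add: u_def algebra_simps)
  \<comment> \<open>Weakening \<open>1 - \<beta>\<close> to 1 in the tampering term leaves a union
    bound over the rounds.\<close>
  also have "\<dots> \<le> \<delta> + (1 - \<beta>) ^ Suc k + 1 * (k * \<delta>)"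
    using \<beta> \<delta> by (intro add_left_mono mult_right_mono) auto
  also have "\<dots> = (1 - \<beta>) ^ Suc k + Suc k * \<delta>"
    by (simp add: algebra_simps)
  finally show ?case .
qed

text \<open>On untampered answers \<open>f\<close> itself witnesses plausibility, so a rejection
  requires a tampered round, and a union bound applies.\<close>

lemma prob_reject_le:
  assumes hit: "\<And>h. length h < q \<Longrightarrow> measure_pmf.prob D (tampered f (A h)) \<le> \<delta>"
    and f: "f \<in> P" and \<delta>: "0 \<le> \<delta>"
    and "length h + k \<le> q"
  shows "pmf (run (pair_tester P D k) A h) False \<le> real k * \<delta>"
  using assms(4)
proof (induction k arbitrary: h)
  case 0
  show ?case by simp
next
  case (Suc k)
  let ?H = "tampered f (A h)"
  have "pmf (run (pair_tester P D (Suc k)) A h) False = (\<integral>z. pmf (case z of (x, y) \<Rightarrow>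
      if plausible P x y [A h x, A h y] then run (pair_tester P D k) A (h @ [[x, y]])
      else return_pmf False) False \<partial>D)"
    by (simp only: run_pair_tester_Suc pmf_bind)
  also have "\<dots> \<le> (\<integral>z. indicat_real ?H z + real k * \<delta> \<partial>D)"
  proof (rule integral_mono)
    show "integrable (measure_pmf D) (\<lambda>z. pmf (case z of (x, y) \<Rightarrow>
      if plausible P x y [A h x, A h y] then run (pair_tester P D k) A (h @ [[x, y]])
      else return_pmf False) False)"
      by (rule integrable_pmf_bounded[of _ 1]) (simp add: pmf_le_1)
    show "integrable (measure_pmf D) (\<lambda>z. indicat_real ?H z + real k * \<delta>)"
      by (rule integrable_pmf_bounded[of _ "1 + real k * \<delta>"]) (use \<delta> in \<open>auto simp: indicator_def\<close>)
    fix z :: "nat \<times> nat"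
    obtain x y where z: "z = (x, y)" by fastforce
    have IH: "pmf (run (pair_tester P D k) A (h @ [[x, y]])) False \<le> real k * \<delta>"
      using Suc.prems by (intro Suc.IH) simp
    show "pmf (case z of (x, y) \<Rightarrow>
      if plausible P x y [A h x, A h y] then run (pair_tester P D k) A (h @ [[x, y]])
      else return_pmf False) False \<le> indicat_real ?H z + real k * \<delta>"
    proof (cases "z \<in> ?H")
      case True
      have "pmf p False \<le> 1 + real k * \<delta>" for p
        using pmf_le_1[of p False] \<delta> by (simp add: add_increasing2)
      then show ?thesis using True by simp
    next
      case False
      then have "A h x = Some (f x)" "A h y = Some (f y)" by (auto simp: tampered_def z)
      then show ?thesis
        using False IH f by (auto simp: z)
    qed
  qed
  also have "\<dots> = measure_pmf.prob D ?H + real k * \<delta>"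
    by (simp add: integrable_pmf_indicator)
  also have "\<dots> \<le> real (Suc k) * \<delta>"
    using hit[of h] Suc.prems by (simp add: algebra_simps)
  finally show ?case .
qed

text \<open>Either both answers are true and \<open>f\<close> is a witness, or one is erased and the
  default applies; no round can reject.\<close>

lemma run_erasure_accept:
  assumes f: "f \<in> P" and D: "\<And>x y. (x, y) \<in> set_pmf D \<Longrightarrow> x \<in> {1..n} \<and> y \<in> {1..n}"
    and A: "\<And>h x. x \<in> {1..n} \<Longrightarrow> A h x \<in> {Some (f x), None}"
  shows "run (pair_tester P D k) A h = return_pmf True"
proof (induction k arbitrary: h)
  case 0
  show ?case by simp
next
  case (Suc k)
  have "plausible P x y [A h x, A h y]" if "(x, y) \<in> set_pmf D" for x y
    using D[OF that] A[of x h] A[of y h] f by auto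
  then have "run (pair_tester P D (Suc k)) A h = bind_pmf D (\<lambda>_. return_pmf True)"
    unfolding run_pair_tester_Suc by (intro bind_pmf_cong) (auto simp: Suc)
  then show ?case by simp
qed

lemma erasure_adversary_answers:
  assumes "erasure_adversary n t f A" "x \<in> {1..n}"
  shows "A h x \<in> {Some (f x), None}"
proof (induction h rule: rev_induct)
  case Nil
  then show ?case using assms by (auto simp: erasure_adversary_def budget_managing_def)
next
  case (snoc xs h)
  have "A (h @ [xs]) x \<in> {A h x, None}"
    using assms unfolding erasure_adversary_def by blast
  then show ?case using snoc by auto
qed

text \<open>Fewer than \<open>k\<close> batches allow at most \<open>k * t\<close> modified
  positions, each queried with probability at most \<open>2 / n\<close>.\<close>

lemma prob_tampered_le:
  assumes n: "1 \<le> n" and A: "budget_managing n t f A" and h: "length h < k" and t: "0 < t"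
  shows "measure_pmf.prob (pair_pmf_dyadic n m) (tampered f (A h)) \<le> 2 * k * t / n"
proof -
  let ?E = "{x. A h x \<noteq> Some (f x)}"
  have "?E \<inter> {1..n} = {x \<in> {1..n}. A [] x \<noteq> A h x}"
    using A by (auto simp: budget_managing_def)
  then have "real (card (?E \<inter> {1..n})) \<le> length h * t"
    using A by (simp add: budget_managing_def Dist_def)
  also have "\<dots> \<le> k * t" using h t by (intro mult_right_mono) auto
  finally have c: "real (card (?E \<inter> {1..n})) \<le> k * t" .
  have "tampered f (A h) = {(x, y). x \<in> ?E \<or> y \<in> ?E}"
    by (simp add: tampered_def)
  then have "measure_pmf.prob (pair_pmf_dyadic n m) (tampered f (A h)) \<le> 2 * card (?E \<inter> {1..n}) / n"
    using prob_hit_le[OF n, of m ?E] by (simp only:)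
  also have "\<dots> \<le> 2 * (k * t) / n"
    using c by (intro divide_right_mono mult_left_mono) auto
  finally show ?thesis by simp
qed

section \<open>Choice of parameters\<close>

text \<open>The scale is cut off at \<open>\<epsilon> * n / 4\<close>, so
  \<open>2 ^ (m + 1) \<le> \<epsilon> * n\<close> and the number \<open>m + 1\<close> of scales is
  at most the logarithm. For \<open>\<epsilon> * n < 8\<close> there is one scale, and
  \<open>lg\<close> is at least 1.\<close>

lemma exists_level:
  assumes "0 < \<epsilon>" "1 \<le> n"
  obtains m :: nat where
    "m = 0 \<and> \<epsilon> * real n < 8 \<or> 2 ^ m \<le> \<epsilon> * real n / 4 \<and> \<epsilon> * real n / 4 < 2 ^ Suc m"
    "real (m + 1) \<le> lg (\<epsilon> * real n)"
proof (cases "\<epsilon> * real n < 8")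
  case True
  show ?thesis by (rule that[of 0]) (use True in \<open>auto simp: lg_def\<close>)
next
  case False
  define z where "z = \<epsilon> * real n / 4"
  have z: "2 \<le> z" using False by (simp add: z_def)
  obtain m where m: "2 ^ m \<le> nat \<lfloor>z\<rfloor>" "nat \<lfloor>z\<rfloor> < 2 ^ (m + 1)"
    using ex_power_ivl1[of 2 "nat \<lfloor>z\<rfloor>"] z by (auto simp: le_nat_iff le_floor_iff)
  have "real (2 ^ m) \<le> real (nat \<lfloor>z\<rfloor>)" using m(1) by (rule of_nat_mono)
  also have "\<dots> \<le> z" using z by simp
  finally have m1: "2 ^ m \<le> z" by simp
  \<comment> \<open>Powers of 2 are integers, so the bounds on the floor of \<open>z\<close> carry
    over to \<open>z\<close>.\<close>
  have "z < real (nat \<lfloor>z\<rfloor> + 1)" using z by linarith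
  also have "\<dots> \<le> real (2 ^ Suc m)" using m(2) by (intro of_nat_mono) simp
  finally have m2: "z < 2 ^ Suc m" by simp
  have "2 ^ (m + 1) \<le> \<epsilon> * real n" using m1 z by (simp add: z_def)
  then have "log 2 (2 ^ (m + 1)) \<le> log 2 (\<epsilon> * real n)"
    using False by (subst log_le_cancel_iff) auto
  then have "real (m + 1) \<le> log 2 (\<epsilon> * real n)"
    by (simp only: log_pow_cancel)
  then show ?thesis
    using m1 m2 by (intro that[of m]) (auto simp: lg_def z_def)
qed

theorem theorem1p5:
  "\<exists>c C :: real. c > 0 \<and> C > 0 \<and>
    (\<forall>(\<epsilon> :: real) (n :: nat) (P :: (nat \<Rightarrow> real) set) (t :: real).
      0 < \<epsilon> \<longrightarrow> \<epsilon> < 1 \<longrightarrow> 1 \<le> n \<longrightarrow> local_property n P \<longrightarrow>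
      0 < t \<longrightarrow> t \<le> c * \<epsilon>\<^sup>2 * real n / (lg (\<epsilon> * real n))\<^sup>2 \<longrightarrow>
        (\<exists>T q. has_batch_size n 2 T \<and>
           makes_at_most q T \<and> real q \<le> C * (lg (\<epsilon> * real n) / \<epsilon>) \<and>
           is_tester n \<epsilon> P (erasure_adversary n t) T \<and>
           one_sided P (erasure_adversary n t) T) \<and>
        (\<exists>T q. has_batch_size n 2 T \<and>
           makes_at_most q T \<and> real q \<le> C * (lg (\<epsilon> * real n) / \<epsilon>) \<and>
           is_tester n \<epsilon> P (corruption_adversary n t) T))"
proof (rule exI[of _ "1 / 4000"], rule exI[of _ 34], intro conjI[of "_ < _"] allI impI)
  show "(0 :: real) < 1 / 4000" "(0 :: real) < 34" by simp_all
next
  fix \<epsilon> t :: real and n :: nat and P :: "(nat \<Rightarrow> real) set"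
  assume eps: "0 < \<epsilon>" "\<epsilon> < 1" and n: "1 \<le> n" and P: "local_property n P" and t: "0 < t"
    and t_le: "t \<le> 1 / 4000 * \<epsilon>\<^sup>2 * real n / (lg (\<epsilon> * real n))\<^sup>2"
  obtain F where F: "P = {f \<in> seqs n. \<forall>i\<in>{1..<n}. (f i, f (i + 1)) \<notin> F}"
    using P unfolding local_property_def by blast
  define L where "L = lg (\<epsilon> * real n)"
  obtain m :: nat where
    m: "m = 0 \<and> \<epsilon> * real n < 8 \<or> 2 ^ m \<le> \<epsilon> * real n / 4 \<and> \<epsilon> * real n / 4 < 2 ^ Suc m"
    and mL: "real (m + 1) \<le> L"
    using exists_level[OF eps(1) n] unfolding L_def by blast
  define D where "D = pair_pmf_dyadic n m"
  \<comment> \<open>The factor 16 is chosen so that \<open>k * \<beta> \<ge> 2\<close>.\<close>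
  define k where "k = nat \<lceil>16 * (m + 1) / \<epsilon>\<rceil>"
  define T where "T = pair_tester P D k"
  define \<beta> where "\<beta> = \<epsilon> / (8 * real (m + 1))"
  define \<delta> where "\<delta> = 2 * k * t / n"
  have D: "x \<in> {1..n} \<and> y \<in> {1..n}" if "(x, y) \<in> set_pmf D" for x y
    using set_pair_pmf_dyadic[OF n] that unfolding D_def by blast
  have L: "1 \<le> L" by (simp add: L_def lg_def)
  have k_ge: "16 * (m + 1) / \<epsilon> \<le> k" unfolding k_def by linarith
  \<comment> \<open>Rounding up adds at most one round, absorbed by
    \<open>1 \<le> L / \<epsilon>\<close>. With two queries per round this gives the constant
    34.\<close>
  have k_le: "k \<le> 17 * L / \<epsilon>"
  proof -
    have "0 \<le> 16 * real (m + 1) / \<epsilon>" using eps by simp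
    then have "k \<le> 16 * real (m + 1) / \<epsilon> + 1" unfolding k_def by linarith
    also have "\<dots> \<le> 16 * L / \<epsilon> + L / \<epsilon>"
      using mL eps L by (intro add_mono divide_right_mono) (auto simp: field_simps)
    finally show ?thesis by (simp add: field_simps)
  qed
  have \<delta>: "0 \<le> \<delta>" using t by (simp add: \<delta>_def)
  \<comment> \<open>Here \<open>k * \<delta> = 2 * k\<^sup>2 * t / n\<close>, at most
    \<open>2 * 17\<^sup>2 / 4000 = 289 / 2000\<close>; this fixes the constant
    \<open>1 / 4000\<close>. Together with the bound \<open>1 / 6\<close> on
    \<open>(1 - \<beta>) ^ k\<close> the total error is at most \<open>1 / 3\<close>.\<close>
  have k\<delta>: "k * \<delta> \<le> 1 / 6"
  proof -
    have "(real k)\<^sup>2 * t \<le> (17 * L / \<epsilon>)\<^sup>2 * (1 / 4000 * \<epsilon>\<^sup>2 * real n / L\<^sup>2)"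
      using k_le t_le t unfolding L_def by (intro mult_mono power_mono) auto
    also have "\<dots> = 289 / 4000 * n"
      using eps L by (simp add: power_divide power_mult_distrib)
    finally have "2 * ((real k)\<^sup>2 * t) / n \<le> 2 * (289 / 4000 * n) / n"
      by (intro divide_right_mono mult_left_mono) auto
    moreover have "k * \<delta> = 2 * ((real k)\<^sup>2 * t) / n"
      by (simp add: \<delta>_def power2_eq_square)
    moreover have "2 * (289 / 4000 * real n) / n = 289 / 2000"
      using n by simp
    ultimately show ?thesis by linarith
  qed
  have \<beta>: "0 \<le> \<beta>" "\<beta> \<le> 1"
    using eps by (simp_all add: \<beta>_def field_simps)
  have \<beta>k: "(1 - \<beta>) ^ k \<le> 1 / 6"
  proof -
    have "(1 - \<beta>) ^ k \<le> exp (- \<beta>) ^ k"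
      using \<beta> exp_ge_add_one_self[of "- \<beta>"] by (intro power_mono) auto
    also have "\<dots> = exp (- (k * \<beta>))"
      by (simp add: exp_of_nat_mult[symmetric])
    also have "\<dots> \<le> exp (- 2)"
    proof -
      have "16 * (m + 1) / \<epsilon> * \<beta> \<le> k * \<beta>"
        using k_ge \<beta> by (intro mult_right_mono)
      moreover have "16 * (m + 1) / \<epsilon> * \<beta> = 2"
      proof -
        have "16 * w / \<epsilon> * (\<epsilon> / (8 * w)) = 2" if "w \<noteq> 0" for w
          using that eps by simp
        from this[of "real (m + 1)"] show ?thesis by (simp add: \<beta>_def)
      qed
      ultimately show ?thesis by simp
    qed
    also have "\<dots> \<le> 1 / 6"
    proof -
      \<comment> \<open>The quadratic Taylor bound gives \<open>exp 1 \<ge> 5 / 2\<close>, hence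
        \<open>exp 2 \<ge> 25 / 4 > 6\<close>.\<close>
      have "(5 / 2 :: real) \<le> exp 1"
        using exp_lower_Taylor_quadratic[of "1 :: real"] by simp
      then have "(5 / 2) * (5 / 2) \<le> exp 1 * exp (1 :: real)"
        by (intro mult_mono) auto
      then have "6 \<le> exp (2 :: real)" by (simp add: exp_add[symmetric])
      then show ?thesis by (simp add: exp_minus field_simps)
    qed
    finally show ?thesis .
  qed
  have hit: "measure_pmf.prob D (tampered f (A h)) \<le> \<delta>"
    if "budget_managing n t f A" "length h < k" for f A h
    using prob_tampered_le[OF n that t] by (simp add: D_def \<delta>_def)
  \<comment> \<open>The error bounds follow from the budget, which both kinds of adversary obey, so
    a general \<open>Adv\<close> covers both with the same \<open>T\<close>.\<close>
  have tester: "is_tester n \<epsilon> P Adv T"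
    if Adv: "\<And>f A. Adv f A \<Longrightarrow> budget_managing n t f A" for Adv
    unfolding is_tester_def
  proof (intro ballI allI impI conjI)
    fix f A assume f: "f \<in> seqs n" and A: "Adv f A"
    { assume "f \<in> P"
      then have "pmf (run T A []) False \<le> k * \<delta>"
        unfolding T_def by (intro prob_reject_le[of k]) (auto intro: hit Adv A \<delta>)
      then show "2 / 3 \<le> pmf (run T A []) True"
        using k\<delta> pmf_bool_sum[of "run T A []"] by linarith }
    { assume "far_from n \<epsilon> P f"
      then have "\<beta> \<le> measure_pmf.prob D {(x, y). incompatible P f x y}"
        unfolding D_def \<beta>_def
        by (intro prob_incompatible_ge[OF n] far_many_incompatible[OF F f _ eps n m])
      then have "pmf (run T A []) True \<le> (1 - \<beta>) ^ k + k * \<delta>"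
        unfolding T_def by (intro prob_accept_le[of k]) (auto intro: hit Adv A \<delta> \<beta>)
      then show "2 / 3 \<le> pmf (run T A []) False"
        using k\<delta> \<beta>k pmf_bool_sum[of "run T A []"] by linarith }
  qed
  have size: "has_batch_size n 2 T"
    unfolding T_def by (rule has_batch_size_pair_tester) (rule D)
  have queries: "makes_at_most (2 * k) T"
    unfolding T_def by (rule makes_at_most_pair_tester)
  have "real (2 * k) \<le> 34 * (lg (\<epsilon> * real n) / \<epsilon>)"
    using k_le by (simp add: L_def)
  moreover have "one_sided P (erasure_adversary n t) T"
    unfolding one_sided_def
  proof (intro ballI allI impI)
    fix f A assume "f \<in> P" "erasure_adversary n t f A"
    then have "run T A [] = return_pmf True"
      unfolding T_def
      by (intro run_erasure_accept[where n = n and f = f] erasure_adversary_answers D)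
    then show "pmf (run T A []) True = 1" by simp
  qed
  ultimately show "(\<exists>T q. has_batch_size n 2 T \<and>
           makes_at_most q T \<and> real q \<le> 34 * (lg (\<epsilon> * real n) / \<epsilon>) \<and>
           is_tester n \<epsilon> P (erasure_adversary n t) T \<and>
           one_sided P (erasure_adversary n t) T) \<and>
        (\<exists>T q. has_batch_size n 2 T \<and>
           makes_at_most q T \<and> real q \<le> 34 * (lg (\<epsilon> * real n) / \<epsilon>) \<and>
           is_tester n \<epsilon> P (corruption_adversary n t) T)"
    using size queries tester[of "erasure_adversary n t"] tester[of "corruption_adversary n t"]
    unfolding erasure_adversary_def corruption_adversary_def by blast
qed

end
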